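(* Let $(X,\rho)$ be a complete metric space with $|X|\geq 3$, let $\lambda\in[0,\tfrac12)$, and let $T:X\to CB(X)$ be a multivalued $\lambda$-contracting perimeters of triangles mapping on $X$, i.e. $$H(Tx,Ty)+H(Ty,Tz)+H(Tx,Tz)\leq \lambda\left(\rho(x,y)+\rho(y,z)+\rho(x,z)\right)$$ for all three pairwise distinct points $x,y,z\in X$. If $T$ does not possess periodic points of prime period $2$, then $T$ has a fixed point, i.e. there exists $x\in X$ with $x\in Tx$.
   Context: For a metric space $(X,\rho)$, $CB(X)$ denotes the class of all nonempty closed and bounded subsets of $X$, and $H$ is the Pompeiu–Hausdorff metric on $CB(X)$ induced by $\rho$: $H(A,B)=\max\{\sup_{a\in A}\rho(a,B),\ \sup_{b\in B}\rho(b,A)\}$, where $\rho(a,B)=\inf_{b\in B}\rho(a,b)$. For a multivalued mapping $T$ on $X$, the iterates are $T^1x=Tx$ and $T^{n+1}x=\bigcup_{w\in T^n x}Tw$. A point $x\in X$ is a periodic point of period $n$ (with $n\ge 1$) if $x\in T^nx$; the prime period of $x$ is the smallest positive integer $n$ for which $x\in T^nx$. Thus $x$ is a periodic point of prime period $2$ iff $x\in T^2x$ and $x\notin Tx$. *)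

theory Defs
  imports "HOL-Analysis.Analysis"
begin

definition CB :: "'a::metric_space set set" where
  "CB = {A. A \<noteq> {} \<and> closed A \<and> bounded A}"

(* Pompeiu-Hausdorff distance. The suprema are real-valued, so they are meaningful
   only when bounded above, as they are for A, B in CB. *)
definition hausdorff_dist :: "'a::metric_space set \<Rightarrow> 'a set \<Rightarrow> real" where
  "hausdorff_dist A B = max (SUP a\<in>A. infdist a B) (SUP b\<in>B. infdist b A)"

definition contracting_perimeters :: "real \<Rightarrow> ('a::metric_space \<Rightarrow> 'a set) \<Rightarrow> bool" where
  "contracting_perimeters l T \<longleftrightarrow>
     (\<forall>x y z. x \<noteq> y \<and> y \<noteq> z \<and> x \<noteq> z \<longrightarrow>
        hausdorff_dist (T x) (T y) + hausdorff_dist (T y) (T z) + hausdorff_dist (T x) (T z)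
          \<le> l * (dist x y + dist y z + dist x z))"

(* Starting the recursion at 0 with the singleton {x} gives mv_iterate T 1 = T. *)
primrec mv_iterate :: "('a \<Rightarrow> 'a set) \<Rightarrow> nat \<Rightarrow> 'a \<Rightarrow> 'a set" where
  "mv_iterate T 0 x = {x}"
| "mv_iterate T (Suc n) x = (\<Union>w\<in>mv_iterate T n x. T w)"

lemma mv_iterate_1: "mv_iterate T 1 x = T x"
  by simp

definition periodic_point :: "('a \<Rightarrow> 'a set) \<Rightarrow> nat \<Rightarrow> 'a \<Rightarrow> bool" where
  "periodic_point T n x \<longleftrightarrow> n \<ge> 1 \<and> x \<in> mv_iterate T n x"

definition prime_periodic_point :: "('a \<Rightarrow> 'a set) \<Rightarrow> nat \<Rightarrow> 'a \<Rightarrow> bool" where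
  "prime_periodic_point T n x \<longleftrightarrow>
     periodic_point T n x \<and> (\<forall>m<n. \<not> periodic_point T m x)"

lemma prime_periodic_point_2_iff:
  "prime_periodic_point T 2 x \<longleftrightarrow> x \<in> (\<Union>w\<in>T x. T w) \<and> x \<notin> T x"
  by (auto simp: prime_periodic_point_def periodic_point_def numeral_2_eq_2 less_Suc_eq)

end

theory Submission
  imports Defs
begin

text \<open>If \<open>T\<close> has neither fixed points nor points of prime period 2, any three consecutive points
  of an orbit \<open>x\<^sub>n\<^sub>+\<^sub>1 \<in> T x\<^sub>n\<close> are pairwise distinct. The triangle inequality on both sides of the
  contraction condition then gives \<open>H (T x\<^sub>n) (T x\<^sub>n\<^sub>+\<^sub>1) \<le> l (d\<^sub>n + d\<^sub>n\<^sub>+\<^sub>1)\<close> for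
  \<open>d\<^sub>n = dist x\<^sub>n x\<^sub>n\<^sub>+\<^sub>1\<close>, so a nearly distance-minimising choice of each \<open>x\<^sub>n\<^sub>+\<^sub>2\<close>
  makes \<open>d\<^sub>n\<close> decay geometrically because \<open>l < 1/2\<close>. The limit of the orbit is a fixed point.\<close>

lemma bdd_above_infdist_image:
  assumes "bounded A"
  shows "bdd_above ((\<lambda>a. infdist a B) ` A)"
proof (cases "B = {}")
  \<comment> \<open>\<open>infdist\<close> to the empty set is 0 by convention.\<close>
  case True
  then show ?thesis by (auto simp: infdist_def)
next
  case False
  then obtain b where b: "b \<in> B" by blast
  obtain e where "\<forall>a\<in>A. dist b a \<le> e"
    using assms bounded_any_center by blast
  then show ?thesis
    by (intro bdd_aboveI2[where M = e]) (metis b dist_commute infdist_le2)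
qed

lemma hausdorff_dist_commute: "hausdorff_dist A B = hausdorff_dist B A"
  by (simp add: hausdorff_dist_def max.commute)

lemma infdist_le_hausdorff_dist:
  assumes "bounded A" "a \<in> A"
  shows "infdist a B \<le> hausdorff_dist A B"
  unfolding hausdorff_dist_def
  using cSUP_upper[OF assms(2) bdd_above_infdist_image[OF assms(1)]]
  by (rule max.coboundedI1)

lemma hausdorff_dist_nonneg:
  assumes "bounded A" "A \<noteq> {}"
  shows "0 \<le> hausdorff_dist A B"
  using assms infdist_le_hausdorff_dist infdist_nonneg order_trans by (metis ex_in_conv)

text \<open>Going from \<open>a\<close> to \<open>C\<close> through a point of \<open>B\<close>
  costs at most \<open>hausdorff_dist B C\<close> extra; the infimum over these points gives the
  bound.\<close>

lemma infdist_le_infdist_plus_hausdorff_dist: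
  assumes "bounded B" "B \<noteq> {}"
  shows "infdist a C \<le> infdist a B + hausdorff_dist B C"
proof -
  have "infdist a C - hausdorff_dist B C \<le> dist a b" if "b \<in> B" for b
    using infdist_triangle[of a C b] infdist_le_hausdorff_dist[OF assms(1) that, of C] by simp
  then have "infdist a C - hausdorff_dist B C \<le> infdist a B"
    unfolding infdist_notempty[OF assms(2)] by (intro cINF_greatest assms(2))
  then show ?thesis by simp
qed

lemma hausdorff_dist_triangle:
  assumes "bounded A" "A \<noteq> {}" "bounded B" "B \<noteq> {}" "bounded C" "C \<noteq> {}"
  shows "hausdorff_dist A C \<le> hausdorff_dist A B + hausdorff_dist B C"
proof -
  have "infdist a C \<le> hausdorff_dist A B + hausdorff_dist B C" if "a \<in> A" for a
    using infdist_le_infdist_plus_hausdorff_dist[OF assms(3,4), of a C]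
      infdist_le_hausdorff_dist[OF assms(1) that, of B] by simp
  moreover have "infdist c A \<le> hausdorff_dist A B + hausdorff_dist B C" if "c \<in> C" for c
    using infdist_le_infdist_plus_hausdorff_dist[OF assms(3,4), of c A]
      infdist_le_hausdorff_dist[OF assms(5) that, of B]
    by (simp add: hausdorff_dist_commute)
  ultimately show ?thesis
    unfolding hausdorff_dist_def[of A C] using assms(2,6)
    by (intro max.boundedI cSUP_least) auto
qed

lemma Cauchy_if_geometric_steps:
  fixes x :: "nat \<Rightarrow> 'a::metric_space"
  assumes q: "0 \<le> q" "q < 1"
    and step: "\<And>n. dist (x (Suc n)) (x (Suc (Suc n))) \<le> q * dist (x n) (x (Suc n))"
  shows "Cauchy x"
proof -
  define C where "C = dist (x 0) (x 1) / (1 - q)"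
  \<comment> \<open>The bound equals \<open>(q ^ n - q ^ Suc n) * C\<close>, so sums of consecutive
    steps telescope.\<close>
  have D: "dist (x n) (x (Suc n)) \<le> q ^ n * ((1 - q) * C)" for n
  proof (induction n)
    case 0
    then show ?case using q by (simp add: C_def)
  next
    case (Suc n)
    then show ?case
      using step[of n] mult_left_mono[OF Suc q(1)] by (simp add: mult.assoc)
  qed
  have E: "dist (x m) (x (m + k)) \<le> (q ^ m - q ^ (m + k)) * C" for m k
  proof (induction k)
    case (Suc k)
    then show ?case
      using D[of "m + k"] dist_triangle[of "x m" "x (Suc (m + k))" "x (m + k)"]
      by (simp add: algebra_simps)
  qed simp
  have C: "0 \<le> C" using q by (simp add: C_def)
  have F: "dist (x m) (x n) \<le> q ^ m * C" if "m \<le> n" for m n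
  proof -
    have "0 \<le> q ^ n * C" using q C by simp
    then show ?thesis
      using E[of m "n - m"] that by (simp add: algebra_simps)
  qed
  have lim: "(\<lambda>m. q ^ m * C) \<longlonglongrightarrow> 0"
    using LIMSEQ_realpow_zero[OF q] tendsto_mult_left_zero by blast
  show ?thesis
    unfolding Cauchy_altdef
  proof (intro allI impI)
    fix e :: real
    assume "0 < e"
    then obtain M where "\<And>m. m \<ge> M \<Longrightarrow> q ^ m * C < e"
      using order_tendstoD(2)[OF lim] unfolding eventually_sequentially by blast
    then show "\<exists>M. \<forall>m\<ge>M. \<forall>n>m. dist (x m) (x n) < e"
      using F by (meson less_imp_le order_le_less_trans)
  qed
qed

theorem corollary2:
  fixes T :: "'a::complete_space \<Rightarrow> 'a set" and l :: real
  assumes "infinite (UNIV :: 'a set) \<or> card (UNIV :: 'a set) \<ge> 3"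
    and "0 \<le> l" and "l < 1 / 2"
    and "\<And>x. T x \<in> CB"
    and "contracting_perimeters l T"
    and "\<not> (\<exists>x. prime_periodic_point T 2 x)"
  shows "\<exists>x. x \<in> T x"
proof (rule ccontr)
  assume no_fix: "\<nexists>x. x \<in> T x"
  let ?H = "\<lambda>x y. hausdorff_dist (T x) (T y)"
  have T: "T x \<noteq> {}" "closed (T x)" "bounded (T x)" for x
    using assms(4)[of x] by (auto simp: CB_def)
  have contr: "?H x y + ?H y z + ?H x z \<le> l * (dist x y + dist y z + dist x z)"
    if "x \<noteq> y" "y \<noteq> z" "x \<noteq> z" for x y z
    using assms(5) that by (auto simp: contracting_perimeters_def)
  \<comment> \<open>\<open>x = y\<close> or \<open>y = z\<close> would give a fixed point;
    \<open>x = z\<close> would give a point of prime period 2.\<close>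
  have distinct: "x \<noteq> y \<and> y \<noteq> z \<and> x \<noteq> z" if "y \<in> T x" "z \<in> T y" for x y z
    using assms(6) no_fix that unfolding prime_periodic_point_2_iff by blast
  \<comment> \<open>Since \<open>l < 1/2\<close>, this choice satisfies both \<open>h > 1\<close>
    and \<open>h * l < 1/2\<close>. The factor \<open>q\<close> comes from solving
    \<open>d' \<le> h * l * (d + d')\<close> for \<open>d'\<close>, and \<open>h * l < 1/2\<close>
    makes it less than 1.\<close>
  define h where "h = 1 / (l + 1 / 2)"
  define q where "q = h * l / (1 - h * l)"
  have h: "1 < h" "0 \<le> h * l" "h * l < 1 / 2"
    using assms(2,3) by (auto simp: h_def field_simps)
  have q: "0 \<le> q" "q < 1"
    using h by (auto simp: q_def field_simps)
  have step: "\<exists>z\<in>T y. dist y z \<le> q * dist x y" if "y \<in> T x" for x y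
  proof -
    \<comment> \<open>A nearest point of \<open>T y\<close> may not exist. As the distance is
      positive, enlarging it by \<open>h > 1\<close> leaves room for a point
      \<open>z\<close>.\<close>
    have "0 < infdist y (T y)"
      using no_fix T in_closed_iff_infdist_zero[of "T y" y] infdist_nonneg[of y "T y"]
      by (metis order_le_less)
    then have "infdist y (T y) < h * infdist y (T y)"
      using h(1) by simp
    then obtain z where z: "z \<in> T y" "dist y z < h * infdist y (T y)"
      using cINF_less_iff[OF T(1), of "dist y" y] bdd_below_image_dist T(1)
      unfolding infdist_notempty[OF T(1)] by auto
    \<comment> \<open>The triangle inequality bounds one copy of \<open>?H x y\<close> by the other
      two sides.\<close>
    have "2 * ?H x y \<le> ?H x y + ?H y z + ?H x z"
      using hausdorff_dist_triangle[of "T x" "T z" "T y"] T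
      by (simp add: hausdorff_dist_commute)
    also have "\<dots> \<le> l * (dist x y + dist y z + dist x z)"
      using distinct[OF that z(1)] by (intro contr) auto
    also have "\<dots> \<le> l * (2 * (dist x y + dist y z))"
      using dist_triangle[of x z y] assms(2) by (intro mult_left_mono) auto
    finally have "?H x y \<le> l * (dist x y + dist y z)" by (simp add: algebra_simps)
    then have "infdist y (T y) \<le> l * (dist x y + dist y z)"
      using infdist_le_hausdorff_dist[OF T(3) that, of "T y"] by simp
    then have "dist y z \<le> h * (l * (dist x y + dist y z))"
      using z(2) h(1) by (meson less_imp_le mult_left_mono order_trans zero_le_one)
    then have "dist y z \<le> q * dist x y"
      using h by (simp add: q_def field_simps)
    with z(1) show ?thesis by blast
  qed
  \<comment> \<open>The choice runs over pairs of consecutive orbit points, because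
    \<open>step\<close> needs both the current point and its predecessor.\<close>
  have "\<exists>f. \<forall>n. (snd (f n) \<in> T (fst (f n))) \<and> (fst (f (Suc n)) = snd (f n) \<and>
      dist (snd (f n)) (snd (f (Suc n))) \<le> q * dist (fst (f n)) (snd (f n)))"
  proof (rule dependent_nat_choice)
    show "\<exists>p. snd p \<in> T (fst p)"
      using T(1)[of undefined] by auto
    show "\<exists>p'. snd p' \<in> T (fst p') \<and> (fst p' = snd p \<and>
        dist (snd p) (snd p') \<le> q * dist (fst p) (snd p))"
      if "snd p \<in> T (fst p)" for p and n :: nat
      using step[OF that] by auto
  qed
  then obtain f where f: "\<And>n. snd (f n) \<in> T (fst (f n))" "\<And>n. fst (f (Suc n)) = snd (f n)"
    "\<And>n. dist (snd (f n)) (snd (f (Suc n))) \<le> q * dist (fst (f n)) (snd (f n))"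
    by blast
  define x where "x n = fst (f n)" for n
  have orbit: "x (Suc n) \<in> T (x n)" for n
    using f(1,2) by (simp add: x_def)
  have "Cauchy x"
    using q f(2,3) by (intro Cauchy_if_geometric_steps[of q]) (auto simp: x_def)
  then obtain z where z: "x \<longlonglongrightarrow> z"
    using Cauchy_convergent unfolding convergent_def by blast
  define e where "e n = dist (x n) z" for n
  have e: "e \<longlonglongrightarrow> 0"
    using z tendsto_dist_iff unfolding e_def by blast
  have e1: "(\<lambda>n. e (Suc n)) \<longlonglongrightarrow> 0" using e by (rule LIMSEQ_Suc)
  have e2: "(\<lambda>n. e (Suc (Suc n))) \<longlonglongrightarrow> 0" using e1 by (rule LIMSEQ_Suc)
  \<comment> \<open>The point \<open>b\<close> serves as third vertex for comparing
    \<open>T a\<close> with \<open>T z\<close>; the side \<open>dist a b\<close> is estimated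
    through \<open>z\<close>.\<close>
  have H_le: "?H a z \<le> l * (2 * (dist a z + dist b z))" if "a \<noteq> z" "b \<noteq> z" "a \<noteq> b" for a b
  proof -
    have "?H a z \<le> ?H a b + ?H b z + ?H a z"
      using hausdorff_dist_nonneg[OF T(3,1), of a "T b"] hausdorff_dist_nonneg[OF T(3,1), of b "T z"]
      by simp
    also have "\<dots> \<le> l * (dist a b + dist b z + dist a z)"
      using that by (intro contr) auto
    also have "\<dots> \<le> l * (2 * (dist a z + dist b z))"
      using dist_triangle2[of a b z] assms(2) by (intro mult_left_mono) auto
    finally show ?thesis .
  qed
  \<comment> \<open>The orbit may hit \<open>z\<close>. If \<open>x n = z\<close>, then
    \<open>x (Suc n)\<close> lies in \<open>T z\<close>. Otherwise the third vertex is
    \<open>x (Suc n)\<close>, or \<open>x (Suc (Suc n))\<close> when \<open>x (Suc n) = z\<close>.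
    Summing three errors covers all cases at once.\<close>
  have bound: "infdist z (T z) \<le> e (Suc n) + l * (2 * (e n + e (Suc n) + e (Suc (Suc n))))" for n
  proof -
    have d: "x n \<noteq> x (Suc n)" "x (Suc n) \<noteq> x (Suc (Suc n))" "x n \<noteq> x (Suc (Suc n))"
      using distinct[OF orbit orbit, of n] by auto
    have nonneg: "0 \<le> l * (2 * e k)" for k using assms(2) by (simp add: e_def)
    have "infdist (x (Suc n)) (T z) \<le> l * (2 * (e n + e (Suc n) + e (Suc (Suc n))))"
    proof (cases "x n = z")
      case True
      then show ?thesis
        using orbit[of n] nonneg[of n] nonneg[of "Suc n"] nonneg[of "Suc (Suc n)"]
        by (simp add: algebra_simps)
    next
      case False
      have "?H (x n) z \<le> l * (2 * (e n + e (Suc n) + e (Suc (Suc n))))"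
      proof (cases "x (Suc n) = z")
        case True
        then show ?thesis
          using H_le[of "x n" "x (Suc (Suc n))"] False d nonneg[of "Suc n"]
          by (simp add: e_def algebra_simps)
      next
        case False
        then show ?thesis
          using H_le[of "x n" "x (Suc n)"] \<open>x n \<noteq> z\<close> d nonneg[of "Suc (Suc n)"]
          by (simp add: e_def algebra_simps)
      qed
      then show ?thesis
        using infdist_le_hausdorff_dist[OF T(3) orbit, of n "T z"] by simp
    qed
    then show ?thesis
      using infdist_triangle[of z "T z" "x (Suc n)"] by (simp add: e_def dist_commute)
  qed
  have "(\<lambda>n. e (Suc n) + l * (2 * (e n + e (Suc n) + e (Suc (Suc n)))))
      \<longlonglongrightarrow> 0 + l * (2 * (0 + 0 + 0))"
    by (intro tendsto_intros e e1 e2)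
  then have "infdist z (T z) \<le> 0 + l * (2 * (0 + 0 + 0))"
    using bound by (intro LIMSEQ_le_const) auto
  then have "z \<in> T z"
    using T[of z] in_closed_iff_infdist_zero infdist_nonneg[of z "T z"] by force
  with no_fix show False by blast
qed

end
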